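(* Let $n\ge 1$ and let $\lambda_1,\dots,\lambda_n>0$ be the detection rates at $n$ locations, with all travel times between locations equal to zero. Put $$ r_i=\frac{1/\lambda_i}{\sum_{j=1}^n 1/\lambda_j},\qquad i=1,\dots,n. $$ Then the policy that continuously allocates the constant fraction $r_i$ of effort to location $i$ (i.e. $h_i(t)=r_i$ for all $t$ and all $i$) is optimal: it minimizes $\max_{i\in\{1,\dots,n\}} v_i$ over all policies. Moreover, under this policy the expected time to detect an attacker is the same at every location and equals $$ v_i=\sum_{j=1}^n\frac1{\lambda_j}\qquad\text{for every } i. $$
   Context: Policies (zero travel times): the patroller may split effort among locations. A policy consists of a number $c>0$ and measurable functions $h_1,\dots,h_n:[0,c]\to[0,1]$ with $\sum_{i=1}^n h_i(t)=1$ for all $t\in[0,c]$; the pattern is repeated indefinitely, i.e. each $h_i$ is extended $c$-periodically to $[0,\infty)$. At time $t$ the instantaneous detection rate at location $i$ is $\lambda_i h_i(t)$: an attacker arriving at location $i$ at time $t$ is still undetected at time $t+u$ with probability $\exp\left(-\lambda_i\int_t^{t+u}h_i(w)\,dw\right)$. Let $g_i(t)=\int_0^\infty \exp\left(-\lambda_i\int_t^{t+u}h_i(w)\,dw\right)du\in[0,\infty]$ be the expected time to detect an attacker who arrives at location $i$ at time $t$, and let $v_i=\frac1c\int_0^c g_i(t)\,dt$ be the expected time to detect an attacker at location $i$ whose arrival time is uniform over a cycle. *)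

theory Defs
  imports "HOL-Analysis.Analysis" "HOL-Library.Real_Mod"
begin

text \<open>Locations are the indices in \<open>{1..n}\<close>. A policy is a cycle length \<open>c\<close> together with the
  effort allocations \<open>h i\<close>, of which only the values on \<open>{0..c}\<close> are relevant. Measurability is
  Lebesgue measurability, the most general reading, which includes all Borel policies.\<close>

definition is_policy :: "nat \<Rightarrow> real \<Rightarrow> (nat \<Rightarrow> real \<Rightarrow> real) \<Rightarrow> bool" where
  "is_policy n c h \<longleftrightarrow> c > 0 \<and>
     (\<forall>i\<in>{1..n}. h i \<in> borel_measurable (lebesgue_on {0..c}) \<and> (\<forall>t\<in>{0..c}. h i t \<in> {0..1})) \<and>
     (\<forall>t\<in>{0..c}. (\<Sum>i=1..n. h i t) = 1)"

text \<open>The values of \<open>f\<close> at \<open>0\<close> and \<open>c\<close> need not agree, so the extension repeats the pattern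
  on the half-open interval \<open>{0..<c}\<close>. This affects only a null set.\<close>

definition periodic_extension :: "real \<Rightarrow> (real \<Rightarrow> real) \<Rightarrow> real \<Rightarrow> real" where
  "periodic_extension c f t = f (t rmod c)"

definition undetected_prob ::
    "(nat \<Rightarrow> real) \<Rightarrow> real \<Rightarrow> (nat \<Rightarrow> real \<Rightarrow> real) \<Rightarrow> nat \<Rightarrow> real \<Rightarrow> real \<Rightarrow> real" where
  "undetected_prob lam c h i t u =
     exp (- lam i * (LINT w:{t..t+u}|lebesgue. periodic_extension c (h i) w))"

text \<open>The expected detection times below may be infinite (a location may receive no effort),
  so they are extended nonnegative reals.\<close>

definition detection_time ::
    "(nat \<Rightarrow> real) \<Rightarrow> real \<Rightarrow> (nat \<Rightarrow> real \<Rightarrow> real) \<Rightarrow> nat \<Rightarrow> real \<Rightarrow> ennreal" where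
  "detection_time lam c h i t = (\<integral>\<^sup>+u\<in>{0..}. ennreal (undetected_prob lam c h i t u) \<partial>lebesgue)"

definition mean_detection_time ::
    "(nat \<Rightarrow> real) \<Rightarrow> real \<Rightarrow> (nat \<Rightarrow> real \<Rightarrow> real) \<Rightarrow> nat \<Rightarrow> ennreal" where
  "mean_detection_time lam c h i =
     ennreal (1 / c) * (\<integral>\<^sup>+t\<in>{0..c}. detection_time lam c h i t \<partial>lebesgue)"

definition worst_detection_time ::
    "nat \<Rightarrow> (nat \<Rightarrow> real) \<Rightarrow> real \<Rightarrow> (nat \<Rightarrow> real \<Rightarrow> real) \<Rightarrow> ennreal" where
  "worst_detection_time n lam c h = Max (mean_detection_time lam c h ` {1..n})"

definition optimal_policy :: "nat \<Rightarrow> (nat \<Rightarrow> real) \<Rightarrow> real \<Rightarrow> (nat \<Rightarrow> real \<Rightarrow> real) \<Rightarrow> bool" where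
  "optimal_policy n lam c h \<longleftrightarrow>
     is_arg_min (\<lambda>(c, h). worst_detection_time n lam c h) (\<lambda>(c, h). is_policy n c h) (c, h)"

definition effort_fraction :: "nat \<Rightarrow> (nat \<Rightarrow> real) \<Rightarrow> nat \<Rightarrow> real" where
  "effort_fraction n lam i = (1 / lam i) / (\<Sum>j=1..n. 1 / lam j)"

end

theory Submission
  imports Defs
begin

text \<open>
  The point is that a location cannot do better, for a given average share of effort, than to
  receive that effort evenly. Suppose that a location with detection rate \<open>\<lambda>\<close> receives the average
  share \<open>m\<close> of the effort over a cycle of length \<open>c\<close>, and let \<open>H\<close> be its cumulative effort. An
  attack arriving at time \<open>t\<close> survives a further time \<open>u\<close> with probability
  \<open>exp (- \<lambda> * (H (t + u) - H t))\<close>. As \<open>H\<close> grows by the same amount \<open>c * m\<close> over every cycle, the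
  increment \<open>H (t + u) - H t\<close>, averaged over the arrival time \<open>t\<close>, is exactly \<open>m * u\<close>
  (\<open>integral_increment_over_period\<close>). By convexity of \<open>exp\<close>, the average survival probability is
  therefore at least \<open>exp (- \<lambda> * m * u)\<close> (\<open>mean_exp_cumulative_effort_ge\<close>). Exchanging the integrals
  over \<open>t\<close> and \<open>u\<close> turns this into the bound \<open>1 / (\<lambda> * m)\<close> for the mean detection time
  (\<open>mean_detection_time_ge\<close>), which a constant allocation attains (\<open>mean_detection_time_const\<close>).

  The average shares of all locations add up to one, and so do the fractions \<open>r\<^sub>i\<close>. Hence under any
  policy some location \<open>i\<close> has a share of at most \<open>r\<^sub>i\<close>
  (\<open>exists_location_with_mean_effort_le\<close>), and its mean detection time is at least
  \<open>1 / (\<lambda>\<^sub>i * r\<^sub>i)\<close>. The \<open>r\<^sub>i\<close> are chosen so that this number is the sum of all \<open>1 / \<lambda>\<^sub>j\<close>, whatever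
  \<open>i\<close> is.
\<close>

section \<open>Functions with periodic increments the half-line\<close>

lemma integral_shift_real:
  fixes f :: "real \<Rightarrow> real"
  assumes "f integrable_on {a + c..b + c}"
  shows "integral {a..b} (\<lambda>x. f (x + c)) = integral {a + c..b + c} f"
proof -
  have "(f has_integral integral {a + c..b + c} f) (cbox (a + c) (b + c))"
    using assms by (simp add: has_integral_integral)
  from has_integral_affinity'[OF this, of 1 c]
  show ?thesis by (simp add: integral_unique)
qed

text \<open>The integral is the difference of the integrals of \<open>H\<close> over the windows \<open>{u..u + c}\<close> and
  \<open>{0..c}\<close>. Sliding the window removes \<open>{0..u}\<close> and adds \<open>{c..u + c}\<close>, on which \<open>H\<close> is a copy of its
  values on \<open>{0..u}\<close> raised by \<open>C\<close>.\<close>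

lemma integral_increment_over_period:
  fixes H :: "real \<Rightarrow> real"
  assumes cont: "continuous_on UNIV H" and "c \<ge> 0" "u \<ge> 0"
    and per: "\<And>t. t \<ge> 0 \<Longrightarrow> H (t + c) = H t + C"
  shows "integral {0..c} (\<lambda>t. H (t + u) - H t) = C * u"
proof -
  have int: "H integrable_on {a..b}" for a b
    by (rule integrable_continuous_real) (rule continuous_on_subset[OF cont], simp)
  have int_u: "(\<lambda>t. H (t + u)) integrable_on {0..c}"
    by (intro integrable_continuous_real continuous_on_compose2[OF cont] continuous_intros) auto
  have "integral {c..u + c} H = integral {0..u} (\<lambda>t. H (t + c))"
    using integral_shift_real[of H 0 c u] int by simp
  also have "\<dots> = integral {0..u} (\<lambda>t. H t + C)"
    using per by (intro integral_cong) auto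
  also have "\<dots> = integral {0..u} H + C * u"
    using int \<open>u \<ge> 0\<close> by (subst integral_add) auto
  finally have *: "integral {c..u + c} H = integral {0..u} H + C * u" .
  have "integral {0..c} (\<lambda>t. H (t + u) - H t) = integral {u..c + u} H - integral {0..c} H"
    using integral_shift_real[of H 0 u c] int by (subst integral_diff[OF int_u int]) simp
  also have "integral {u..c + u} H = integral {0..u + c} H - integral {0..u} H"
    using Henstock_Kurzweil_Integration.integral_combine[of 0 u "u + c" H] int assms
    by (simp add: add.commute)
  also have "integral {0..u + c} H = integral {0..c} H + integral {c..u + c} H"
    using Henstock_Kurzweil_Integration.integral_combine[of 0 c "u + c" H] int assms by simp
  finally show ?thesis using * by simp
qed

section \<open>Cumulative effort at one location\<close>

context
  fixes f :: "real \<Rightarrow> real" and c :: real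
  assumes c_pos: "c > 0"
    and meas: "f \<in> borel_measurable (lebesgue_on {0..c})"
    and range: "\<And>t. t \<in> {0..c} \<Longrightarrow> f t \<in> {0..1}"
begin

lemma periodic_extension_add_period [simp]:
  "periodic_extension c f (t + c) = periodic_extension c f t"
proof -
  have "(t + c) rmod c = t rmod c"
    using c_pos by (simp add: rmod_def add_divide_distrib algebra_simps)
  then show ?thesis by (simp add: periodic_extension_def)
qed

lemma periodic_extension_range: "periodic_extension c f t \<in> {0..1}"
  unfolding periodic_extension_def
  using c_pos by (intro range) (auto simp: rmod_nonneg rmod_le)

text \<open>A preimage under the extension is a countable union of translates of a Lebesgue measurable
  subset of \<open>{0..<c}\<close>.\<close>

lemma periodic_extension_measurable: "periodic_extension c f \<in> borel_measurable lebesgue"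
proof (rule measurableI)
  fix B :: "real set" assume "B \<in> sets borel"
  have "f -` B \<inter> {0..c} \<in> sets (lebesgue_on {0..c})"
    using measurable_sets[OF meas \<open>B \<in> sets borel\<close>] by simp
  then have "f -` B \<inter> {0..c} \<in> sets lebesgue"
    by (subst (asm) sets_restrict_space_iff) auto
  then have "(f -` B \<inter> {0..c}) \<inter> {0..<c} \<in> sets lebesgue"
    by (rule sets.Int) simp
  moreover have "(f -` B \<inter> {0..c}) \<inter> {0..<c} = f -` B \<inter> {0..<c}"
    by auto
  ultimately have P: "f -` B \<inter> {0..<c} \<in> sets lebesgue"
    by (simp only:)
  have "periodic_extension c f -` B = (\<Union>k::int. (+) (of_int k * c) ` (f -` B \<inter> {0..<c}))"
  proof (intro equalityI subsetI)
    fix x assume "x \<in> periodic_extension c f -` B"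
    then have "x rmod c \<in> f -` B \<inter> {0..<c}"
      using c_pos by (auto simp: periodic_extension_def rmod_nonneg rmod_less)
    moreover have "x = of_int \<lfloor>x / c\<rfloor> * c + x rmod c"
      using c_pos by (simp add: rmod_def)
    ultimately show "x \<in> (\<Union>k::int. (+) (of_int k * c) ` (f -` B \<inter> {0..<c}))"
      by blast
  next
    fix x assume "x \<in> (\<Union>k::int. (+) (of_int k * c) ` (f -` B \<inter> {0..<c}))"
    then obtain k :: int and z where z: "x = of_int k * c + z" "f z \<in> B" "z \<in> {0..<c}"
      by auto
    then have "x rmod c = z"
      using c_pos by (intro rmod_unique[of _ _ _ k]) auto
    then show "x \<in> periodic_extension c f -` B"
      using z by (simp add: periodic_extension_def)
  qed
  moreover have "(\<Union>k::int. (+) (of_int k * c) ` (f -` B \<inter> {0..<c})) \<in> sets lebesgue"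
    using P by (intro sets.countable_UN'' lebesgue_sets_translation) auto
  ultimately show "periodic_extension c f -` B \<inter> space lebesgue \<in> sets lebesgue"
    by simp
qed simp

lemma periodic_extension_set_integrable:
  "set_integrable lebesgue {a..b} (periodic_extension c f)"
proof (rule measurable_bounded_by_integrable_imp_absolutely_integrable[where g = "\<lambda>_. 1"])
  show "periodic_extension c f \<in> borel_measurable (lebesgue_on {a..b})"
    by (rule measurable_restrict_space1[OF periodic_extension_measurable])
  show "norm (periodic_extension c f x) \<le> 1" for x
    using periodic_extension_range[of x] by simp
qed auto

lemmas periodic_extension_integrable =
  set_lebesgue_integral_eq_integral(1)[OF periodic_extension_set_integrable]

definition cumulative_effort :: "real \<Rightarrow> real" where
  "cumulative_effort t = integral {0..t} (periodic_extension c f)"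

lemma cumulative_effort_diff:
  assumes "0 \<le> s" "s \<le> t"
  shows "cumulative_effort t - cumulative_effort s = integral {s..t} (periodic_extension c f)"
  unfolding cumulative_effort_def
  using Henstock_Kurzweil_Integration.integral_combine[OF assms periodic_extension_integrable]
  by simp

lemma cumulative_effort_lipschitz: "1-lipschitz_on {0..} cumulative_effort"
proof (rule lipschitz_on_leI)
  fix s t :: real assume st: "s \<in> {0..}" "t \<in> {0..}" "s \<le> t"
  let ?I = "integral {s..t} (periodic_extension c f)"
  have "?I \<ge> 0"
    using periodic_extension_range
    by (intro Henstock_Kurzweil_Integration.integral_nonneg periodic_extension_integrable) auto
  moreover have "?I \<le> integral {s..t} (\<lambda>_. 1)"
    using periodic_extension_range
    by (intro integral_le periodic_extension_integrable) auto
  ultimately show "dist (cumulative_effort s) (cumulative_effort t) \<le> 1 * dist s t"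
    using cumulative_effort_diff[of s t] st by (auto simp: dist_real_def)
qed simp

text \<open>Continuity on the whole line, where the function is constantly zero to the left of the origin,
  makes the survival probability jointly Borel measurable in arrival time and delay although the
  effort itself is only Lebesgue measurable.\<close>

lemma cumulative_effort_continuous: "continuous_on UNIV cumulative_effort"
proof -
  have "continuous_on UNIV (\<lambda>t. cumulative_effort (max 0 t))"
    using lipschitz_on_continuous_on[OF cumulative_effort_lipschitz]
    by (rule continuous_on_compose2) (auto intro!: continuous_intros)
  moreover have "cumulative_effort (max 0 t) = cumulative_effort t" for t
    by (cases "t < 0") (auto simp: cumulative_effort_def max_def)
  ultimately show ?thesis by simp
qed

lemma cumulative_effort_add_period:
  assumes "t \<ge> 0"
  shows "cumulative_effort (t + c) = cumulative_effort t + cumulative_effort c"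
proof -
  have "cumulative_effort (t + c) - cumulative_effort c
      = integral {c..t + c} (periodic_extension c f)"
    using assms c_pos by (intro cumulative_effort_diff) auto
  also have "\<dots> = cumulative_effort t"
    using integral_shift_real[OF periodic_extension_integrable, of 0 t c]
    by (simp add: cumulative_effort_def)
  finally show ?thesis by simp
qed

lemma cumulative_effort_cycle: "cumulative_effort c = integral {0..c} f"
  unfolding cumulative_effort_def
proof (rule integral_spike[of "{c}"])
  show "f t = periodic_extension c f t" if "t \<in> {0..c} - {c}" for t
    using that c_pos by (simp add: periodic_extension_def)
qed simp

text \<open>This is Jensen's inequality for the increment \<open>H (t + u) - H t\<close> with \<open>t\<close> uniform on the cycle,
  up to the factor \<open>c\<close>. It is obtained by integrating the tangent of \<open>exp\<close> at the mean exponent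
  \<open>- a * u\<close>, since the deviation from the mean integrates to zero.\<close>

lemma mean_exp_cumulative_effort_ge:
  fixes lambda u :: real
  assumes "u \<ge> 0"
  defines "a \<equiv> lambda * cumulative_effort c / c"
  shows "(\<integral>\<^sup>+t\<in>{0..c}. ennreal (exp (- lambda * (cumulative_effort (t + u) - cumulative_effort t))) \<partial>lborel)
    \<ge> ennreal (c * exp (- a * u))"
proof -
  define D where "D t = cumulative_effort (t + u) - cumulative_effort t" for t
  have D: "continuous_on {0..c} D"
    unfolding D_def
    by (intro continuous_intros continuous_on_compose2[OF cumulative_effort_continuous]) auto
  have "integral {0..c} D = cumulative_effort c * u"
    unfolding D_def
    using integral_increment_over_period[OF cumulative_effort_continuous _ \<open>u \<ge> 0\<close>
        cumulative_effort_add_period] c_pos by simp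
  then have "(D has_integral (cumulative_effort c * u)) {0..c}"
    using integrable_continuous_real[OF D] by (simp add: has_integral_iff)
  from has_integral_mult_right[OF this, of lambda]
  have "((\<lambda>t. (1 + a * u) - lambda * D t) has_integral
      ((1 + a * u) * c - lambda * (cumulative_effort c * u))) {0..c}"
    using c_pos has_integral_const_real[of "1 + a * u" 0 c]
    by (intro has_integral_diff) (auto simp: mult.commute)
  from has_integral_mult_right[OF this, of "exp (- a * u)"]
  have tangent: "((\<lambda>t. exp (- a * u) * ((1 + a * u) - lambda * D t)) has_integral
      c * exp (- a * u)) {0..c}"
    using c_pos by (simp add: a_def field_simps)
  have "continuous_on {0..c} (\<lambda>t. exp (- lambda * D t))"
    by (intro continuous_intros D)
  then have exp_int: "((\<lambda>t. exp (- lambda * D t)) has_integral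
      integral {0..c} (\<lambda>t. exp (- lambda * D t))) {0..c}"
    by (intro integrable_integral integrable_continuous_real)
  have "exp (- a * u) * ((1 + a * u) - lambda * D t) \<le> exp (- lambda * D t)" for t
  proof -
    have "exp (- a * u) * (1 + (a * u - lambda * D t)) \<le> exp (- a * u) * exp (a * u - lambda * D t)"
      by (intro mult_left_mono exp_ge_add_one_self) auto
    also have "\<dots> = exp (- lambda * D t)"
      by (simp flip: exp_add)
    finally show ?thesis by (simp add: algebra_simps)
  qed
  with tangent exp_int have "c * exp (- a * u) \<le> integral {0..c} (\<lambda>t. exp (- lambda * D t))"
    by (rule has_integral_le)
  moreover have "(\<integral>\<^sup>+t\<in>{0..c}. ennreal (exp (- lambda * D t)) \<partial>lborel)
      = ennreal (integral {0..c} (\<lambda>t. exp (- lambda * D t)))"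
    using exp_int by (intro nn_integral_has_integral_lebesgue') auto
  ultimately show ?thesis
    by (simp add: D_def ennreal_leI)
qed

end

section \<open>Detection times\<close>

lemma nn_integral_exp_decay:
  assumes "a > 0"
  shows "(\<integral>\<^sup>+u\<in>{0..}. ennreal (exp (- a * u)) \<partial>lborel) = ennreal (1 / a)"
  using has_integral_exp_minus_to_infinity[OF assms, of 0]
  by (intro nn_integral_has_integral_lebesgue') auto

text \<open>The bound \<open>b\<close> stands in for the rate \<open>\<lambda> * m\<close> itself, which is zero for a location that
  receives no effort; such a location, whose detection time is infinite, then needs no separate
  treatment.\<close>

lemma mean_detection_time_ge:
  assumes c: "c > 0"
    and meas: "h i \<in> borel_measurable (lebesgue_on {0..c})"
    and range: "\<And>t. t \<in> {0..c} \<Longrightarrow> h i t \<in> {0..1}"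
    and b: "b > 0" "lam i * integral {0..c} (h i) / c \<le> b"
  shows "mean_detection_time lam c h i \<ge> ennreal (1 / b)"
proof -
  define H where "H = cumulative_effort (h i) c"
  define a where "a = lam i * H c / c"
  define E where "E t u = ennreal (exp (- lam i * (H (t + u) - H t)))" for t u
  note profile = c meas range
  have "undetected_prob lam c h i t u = exp (- lam i * (H (t + u) - H t))"
    if "t \<ge> 0" "u \<ge> 0" for t u
    unfolding undetected_prob_def H_def
    using that set_lebesgue_integral_eq_integral(2)[OF periodic_extension_set_integrable[OF profile]]
      cumulative_effort_diff[OF profile, of t "t + u"] by simp
  then have E: "ennreal (undetected_prob lam c h i t u) = E t u" if "t \<ge> 0" "u \<ge> 0" for t u
    using that by (simp add: E_def)
  have [measurable]: "H \<in> borel_measurable borel"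
    unfolding H_def
    by (intro borel_measurable_continuous_onI cumulative_effort_continuous[OF profile])
  have E_meas [measurable]: "case_prod E \<in> borel_measurable (borel \<Otimes>\<^sub>M borel)"
    unfolding E_def by measurable
  have det: "detection_time lam c h i t = (\<integral>\<^sup>+u\<in>{0..}. E t u \<partial>lborel)" if "t \<ge> 0" for t
    unfolding detection_time_def nn_integral_completion
    using that E by (intro nn_integral_cong) (auto simp: indicator_def)
  \<comment> \<open>The integrands agree with Borel functions on the relevant ranges, so that the integrals can be
    taken over \<open>lborel\<close>, whose product measure gives the joint measurability needed to exchange
    them.\<close>
  have "(\<integral>\<^sup>+t\<in>{0..c}. detection_time lam c h i t \<partial>lebesgue)
      = (\<integral>\<^sup>+t. (\<integral>\<^sup>+u. E t u * indicator {0..} u * indicator {0..c} t \<partial>lborel) \<partial>lborel)"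
    unfolding nn_integral_completion
    by (intro nn_integral_cong) (auto simp: det indicator_def)
  also have "\<dots> = (\<integral>\<^sup>+u. (\<integral>\<^sup>+t. E t u * indicator {0..} u * indicator {0..c} t \<partial>lborel) \<partial>lborel)"
    by (intro lborel_pair.Fubini'[symmetric]) measurable
  also have "\<dots> = (\<integral>\<^sup>+u\<in>{0..}. (\<integral>\<^sup>+t\<in>{0..c}. E t u \<partial>lborel) \<partial>lborel)"
    by (intro nn_integral_cong) (auto simp: indicator_def)
  also have "\<dots> \<ge> (\<integral>\<^sup>+u\<in>{0..}. ennreal c * ennreal (exp (- b * u)) \<partial>lborel)"
  proof (rule nn_integral_mono)
    fix u :: real
    show "ennreal c * ennreal (exp (- b * u)) * indicator {0..} u
        \<le> (\<integral>\<^sup>+t\<in>{0..c}. E t u \<partial>lborel) * indicator {0..} u"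
    proof (cases "u \<ge> 0")
      case True
      have "a \<le> b"
        using b cumulative_effort_cycle[OF profile] by (simp add: a_def H_def)
      then have "ennreal (c * exp (- b * u)) \<le> ennreal (c * exp (- a * u))"
        using True c by (intro ennreal_leI mult_left_mono) (auto intro: mult_right_mono)
      also have "\<dots> \<le> (\<integral>\<^sup>+t\<in>{0..c}. E t u \<partial>lborel)"
        unfolding E_def a_def H_def by (rule mean_exp_cumulative_effort_ge[OF profile True])
      finally show ?thesis using c True by (simp add: ennreal_mult)
    qed simp
  qed
  also have "(\<integral>\<^sup>+u\<in>{0..}. ennreal c * ennreal (exp (- b * u)) \<partial>lborel) = ennreal c * ennreal (1 / b)"
    using nn_integral_exp_decay[OF \<open>b > 0\<close>]
    by (simp add: mult.assoc nn_integral_cmult)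
  finally have "ennreal (1 / c) * (ennreal c * ennreal (1 / b)) \<le> mean_detection_time lam c h i"
    unfolding mean_detection_time_def by (intro mult_left_mono) auto
  moreover have "ennreal (1 / c) * (ennreal c * ennreal (1 / b)) = ennreal (1 / b)"
    using c b by (simp flip: ennreal_mult)
  ultimately show ?thesis by simp
qed

lemma mean_detection_time_const:
  assumes c: "c > 0" and r: "lam i * r i > 0"
  shows "mean_detection_time lam c (\<lambda>i t. r i) i = ennreal (1 / (lam i * r i))"
proof -
  have "undetected_prob lam c (\<lambda>i t. r i) i t u = exp (- (lam i * r i) * u)" if "u \<ge> 0" for t u
    unfolding undetected_prob_def periodic_extension_def set_lebesgue_integral_def
    using that by simp
  then have "detection_time lam c (\<lambda>i t. r i) i t = ennreal (1 / (lam i * r i))" for t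
    unfolding detection_time_def nn_integral_completion nn_integral_exp_decay[OF r, symmetric]
    by (intro nn_integral_cong) (auto simp: indicator_def)
  then show ?thesis
    unfolding mean_detection_time_def
    using c r by (simp add: nn_integral_cmult_indicator flip: ennreal_mult)
qed

section \<open>Optimality\<close>

lemma exists_location_with_mean_effort_le:
  assumes "n \<ge> 1" and pol: "is_policy n c h" and r: "(\<Sum>i=1..n. r i) = 1"
  shows "\<exists>i\<in>{1..n}. integral {0..c} (h i) / c \<le> r i"
proof (rule ccontr)
  assume "\<not> ?thesis"
  then have less: "r i < integral {0..c} (h i) / c" if "i \<in> {1..n}" for i
    using that by force
  have c: "c > 0" using pol by (simp add: is_policy_def)
  have "h i integrable_on {0..c}" if "i \<in> {1..n}" for i
  proof (rule measurable_bounded_by_integrable_imp_integrable[where g = "\<lambda>_. 1"])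
    show "h i \<in> borel_measurable (lebesgue_on {0..c})"
      using pol that by (simp add: is_policy_def)
    show "norm (h i t) \<le> 1" if "t \<in> {0..c}" for t
      using pol \<open>i \<in> {1..n}\<close> that by (auto simp: is_policy_def)
  qed auto
  then have "(\<Sum>i=1..n. integral {0..c} (h i)) = integral {0..c} (\<lambda>t. \<Sum>i=1..n. h i t)"
    by (intro integral_sum[symmetric]) auto
  also have "\<dots> = integral {0..c} (\<lambda>_. 1)"
    using pol by (intro integral_cong) (auto simp: is_policy_def)
  finally have total: "(\<Sum>i=1..n. integral {0..c} (h i)) = c" using c by simp
  have "(\<Sum>i=1..n. r i) < (\<Sum>i=1..n. integral {0..c} (h i) / c)"
    using less \<open>n \<ge> 1\<close> by (intro sum_strict_mono) auto
  also have "\<dots> = 1"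
    using total c by (simp flip: sum_divide_distrib)
  finally show False using r by simp
qed

theorem theorem3p3:
  fixes n :: nat and lam :: "nat \<Rightarrow> real" and c :: real
  assumes "n \<ge> 1"
    and "\<And>i. i \<in> {1..n} \<Longrightarrow> lam i > 0"
    and "c > 0"
  shows "optimal_policy n lam c (\<lambda>i t. effort_fraction n lam i) \<and>
    (\<forall>i\<in>{1..n}. mean_detection_time lam c (\<lambda>i t. effort_fraction n lam i) i =
       ennreal (\<Sum>j=1..n. 1 / lam j))"
proof -
  define S where "S = (\<Sum>j=1..n. 1 / lam j)"
  let ?r = "effort_fraction n lam"
  have S: "S > 0"
    unfolding S_def using assms by (intro sum_pos) auto
  have r_sum: "(\<Sum>i=1..n. ?r i) = 1"
    unfolding effort_fraction_def S_def[symmetric] sum_divide_distrib[symmetric]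
    using S by simp
  have lam_r: "lam i * ?r i = 1 / S" if "i \<in> {1..n}" for i
    using assms(2)[OF that] by (simp add: effort_fraction_def S_def)
  have r_nonneg: "?r i \<ge> 0" if "i \<in> {1..n}" for i
    using assms(2)[OF that] S by (simp add: effort_fraction_def S_def)
  have r_le: "?r i \<le> 1" if "i \<in> {1..n}" for i
    using member_le_sum[of i "{1..n}" ?r] that r_nonneg r_sum by auto
  have const: "mean_detection_time lam c (\<lambda>i t. ?r i) i = ennreal S" if "i \<in> {1..n}" for i
    using mean_detection_time_const[of c lam i ?r] lam_r[OF that] S \<open>c > 0\<close> by simp
  have const_policy: "is_policy n c (\<lambda>i t. ?r i)"
    unfolding is_policy_def using \<open>c > 0\<close> r_nonneg r_le r_sum by auto
  have "mean_detection_time lam c (\<lambda>i t. ?r i) ` {1..n} = {ennreal S}"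
    using const \<open>n \<ge> 1\<close> by (auto simp: image_iff intro!: bexI[of _ 1])
  then have worst: "worst_detection_time n lam c (\<lambda>i t. ?r i) = ennreal S"
    by (simp add: worst_detection_time_def)
  have lower: "ennreal S \<le> worst_detection_time n lam d h" if pol: "is_policy n d h" for d h
  proof -
    obtain i where i: "i \<in> {1..n}" "integral {0..d} (h i) / d \<le> ?r i"
      using exists_location_with_mean_effort_le[OF \<open>n \<ge> 1\<close> pol r_sum] by blast
    have "lam i * (integral {0..d} (h i) / d) \<le> 1 / S"
      using mult_left_mono[OF i(2), of "lam i"] assms(2)[OF i(1)] lam_r[OF i(1)] by simp
    then have "ennreal (1 / (1 / S)) \<le> mean_detection_time lam d h i"
      using pol i(1) S by (intro mean_detection_time_ge) (auto simp: is_policy_def)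
    also have "\<dots> \<le> worst_detection_time n lam d h"
      unfolding worst_detection_time_def using i(1) by (intro Max_ge) auto
    finally show ?thesis by simp
  qed
  have "optimal_policy n lam c (\<lambda>i t. ?r i)"
    unfolding optimal_policy_def is_arg_min_def
    using const_policy lower worst by (auto simp: not_less)
  with const show ?thesis by (simp add: S_def)
qed

end
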